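(* Let $0<p<1$ and let $(G_m)_{m\ge 0}$ be the duplication--deletion random graph process with parameter $p$. Let $N_m$ be the number of vertices of $G_m$ and let $D_{m,k}$ be the number of vertices of degree $k-1$ in $G_m$ (equivalently, the number of vertices lying in cliques of size $k$). Then for each $k\ge 1$, $$\lim_{m\to\infty}\frac{D_{m,k}}{N_m}=d_k\quad\text{almost surely},$$ where $(d_k)_{k=0}^\infty$ is the unique bounded positive sequence satisfying $$d_0=\frac{1-p}{p},\qquad d_k=\frac{pk\,d_{k-1}+(1-p)k\,d_{k+1}}{k+p}\quad (k\ge 1).$$
   Context: The duplication--deletion random graph process with parameter $p\in(0,1)$: $G_0$ consists of a single isolated vertex. For each integer $m\ge 1$, $G_m$ is generated from $G_{m-1}$ by one of the following steps, the type of step being chosen independently of the past. (i) With probability $p$, a duplication step: choose a vertex $v$ of $G_{m-1}$ uniformly at random, introduce a new vertex $w$, and add edges between $w$ and all neighbours of $v$, and also an edge between $v$ and $w$. (ii) With probability $1-p$, a deletion step: choose a vertex of $G_{m-1}$ uniformly at random and make it isolated by deleting all edges incident to it (the vertex itself remains). At every time the graph is a disjoint union of cliques; a clique of size $k$ means a connected component that is a complete graph on $k$ vertices. *)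

theory Defs
  imports "HOL-Probability.Probability"
begin

datatype graph = Graph (verts: "nat set") (edges: "nat set set")

definition neighbours :: "graph \<Rightarrow> nat \<Rightarrow> nat set" where
  "neighbours g v = {u. {u, v} \<in> edges g}"

definition degree :: "graph \<Rightarrow> nat \<Rightarrow> nat" where
  "degree g v = card (neighbours g v)"

text \<open>Vertices are labelled in order of arrival, starting from the single vertex 0;
  \<open>Suc (Max (verts g))\<close> is thus the next unused label.\<close>

definition duplicate :: "graph \<Rightarrow> nat \<Rightarrow> graph" where
  "duplicate g v =
    (let w = Suc (Max (verts g))
     in Graph (insert w (verts g)) (edges g \<union> (\<lambda>u. {u, w}) ` insert v (neighbours g v)))"

definition isolate :: "graph \<Rightarrow> nat \<Rightarrow> graph" where
  "isolate g v = Graph (verts g) {e \<in> edges g. v \<notin> e}"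

definition dd_step :: "real \<Rightarrow> graph \<Rightarrow> graph pmf" where
  "dd_step p g =
    bind_pmf (bernoulli_pmf p) (\<lambda>dup.
      map_pmf (if dup then duplicate g else isolate g) (pmf_of_set (verts g)))"

text \<open>The process is a Markov chain with kernel \<open>dd_step p\<close>, on an arbitrary probability space.
  The kernel gives the conditional law given the whole past, so in particular the type of
  each step (readable off the number of vertices) is independent of the past.\<close>

locale dd_process = prob_space M for M :: "'w measure" +
  fixes p :: real and G :: "nat \<Rightarrow> 'w \<Rightarrow> graph"
  assumes measurable_G: "\<And>m. G m \<in> measurable M (count_space UNIV)"
    and initial: "AE \<omega> in M. G 0 \<omega> = Graph {0} {}"
    and transition: "\<And>m h g.
      prob {\<omega> \<in> space M. (\<forall>i\<le>m. G i \<omega> = h i) \<and> G (Suc m) \<omega> = g} =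
      prob {\<omega> \<in> space M. \<forall>i\<le>m. G i \<omega> = h i} * pmf (dd_step p (h m)) g"

definition num_verts :: "graph \<Rightarrow> nat" where
  "num_verts g = card (verts g)"

definition num_verts_of_degree :: "nat \<Rightarrow> graph \<Rightarrow> nat" where
  "num_verts_of_degree j g = card {v \<in> verts g. degree g v = j}"

definition limit_sequence :: "real \<Rightarrow> (nat \<Rightarrow> real) \<Rightarrow> bool" where
  "limit_sequence p d \<longleftrightarrow>
    bounded (range d) \<and> (\<forall>k. d k > 0) \<and> d 0 = (1 - p) / p \<and>
    (\<forall>k\<ge>1. d k = (p * real k * d (k - 1) + (1 - p) * real k * d (k + 1)) / (real k + p))"

end

theory Submission imports Defs begin

text \<open>
  Let \<open>x\<^sub>k = D\<^sub>k / N\<close> and \<open>x\<^sub>0 = (1 - p) / p\<close>. A duplication moves a clique of size \<open>k\<close> to size \<open>k + 1\<close>;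
  a deletion moves it to size \<open>k - 1\<close> and creates a clique of size 1. Hence the conditional drift of
  \<open>D\<^sub>k\<close> is \<open>k (p x\<^sub>k\<^sub>-\<^sub>1 + (1 - p) x\<^sub>k\<^sub>+\<^sub>1 - x\<^sub>k)\<close>, with jumps of size at most \<open>k + 1\<close>, so the accumulated
  martingale noise is \<open>o(m)\<close> almost surely (orthogonality of increments along the squares, bounded
  jumps in between), and \<open>N \<sim> p m\<close>. Pathwise, \<open>W\<^sub>k = limsup \<bar>x\<^sub>k - d\<^sub>k\<bar>\<close> is then a bounded subsolution
  of the homogeneous recursion with \<open>W\<^sub>0 = 0\<close>. Comparison with the unbounded supersolution
  \<open>1 / p + (1 + 1/2 + ... + 1/k)\<close> forces such a \<open>W\<close> to vanish, which gives the limit and also the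
  uniqueness of \<open>d\<close>; its existence follows by monotone iteration from 0.
\<close>

section \<open>The limit recursion\<close>

text \<open>The weights are nonnegative and, for \<open>k >= 1\<close>, add up to
  \<open>k / (k + p) < 1\<close>: a nearest-neighbour walk killed with probability
  \<open>p / (k + p)\<close>. Monotonicity and this loss of mass drive the comparison
  arguments.\<close>

definition balance :: "real \<Rightarrow> (nat \<Rightarrow> real) \<Rightarrow> nat \<Rightarrow> real" where
  "balance p d k = (p * real k * d (k - 1) + (1 - p) * real k * d (k + 1)) / (real k + p)"

lemma balance_mono:
  assumes "0 < p" "p < 1" "\<And>k. a k \<le> b k"
  shows "balance p a k \<le> balance p b k"
  unfolding balance_def using assms
  by (intro divide_right_mono add_mono mult_left_mono) auto

text \<open>A maximum principle on an infinite index set. Subtracting a small multiple of an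
  unbounded positive supersolution from \<open>W\<close> makes the difference negative far out, so a
  positive value would yield a positive maximum, which the killing rules out. Letting the multiple
  shrink to 0 gives the claim.\<close>

lemma balance_bounded_subsolution_le_0:
  fixes W :: "nat \<Rightarrow> real"
  assumes p: "0 < p" "p < 1"
    and W0: "W 0 \<le> 0"
    and bdd: "\<And>k. W k \<le> B"
    and sub: "\<And>k. k \<ge> 1 \<Longrightarrow> W k \<le> balance p W k"
  shows "W k \<le> 0"
proof -
  \<comment> \<open>An unbounded supersolution: its increments \<open>1 / k\<close> cost at most 1 in the balance equation,
    which the killing term \<open>p * h k \<ge> 1\<close> pays for.\<close>
  define h :: "nat \<Rightarrow> real" where "h k = 1 / p + harm k" for k
  have h_pos: "h k > 0" for k
    using p harm_nonneg[of k, where 'a = real] by (simp add: h_def add_pos_nonneg)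
  have key: "W k \<le> e * h k" if e: "e > 0" for e k
  proof (rule ccontr)
    assume "\<not> W k \<le> e * h k"
    define V where "V j = W j - e * h j" for j
    have Vk: "V k > 0" using \<open>\<not> W k \<le> e * h k\<close> by (simp add: V_def)
    have "eventually (\<lambda>j. harm j > B / e) sequentially"
      using harm_at_top by (simp add: filterlim_at_top_dense)
    then obtain J where J: "\<And>j. j \<ge> J \<Longrightarrow> harm j > B / e"
      by (auto simp: eventually_sequentially)
    have neg: "V j < 0" if "j \<ge> J" for j
    proof -
      have "B < e * harm j" using J[OF that] e by (simp add: field_simps)
      also have "\<dots> \<le> e * h j" using e p by (simp add: h_def)
      finally show ?thesis using bdd[of j] by (simp add: V_def)
    qed
    \<comment> \<open>Only finitely many indices can compete with \<open>V k > 0\<close>, so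
      \<open>V\<close> attains a global maximum. It lies at some \<open>n >= 1\<close>, where the
      subsolution inequality is available, because \<open>V 0 < 0\<close>.\<close>
    define A where "A = {j. V j \<ge> V k}"
    have "A \<subseteq> {..<J}" using neg Vk by (force simp: A_def not_le[symmetric])
    then have "finite A" by (rule finite_subset) simp
    moreover have "k \<in> A" by (simp add: A_def)
    ultimately obtain n where n: "n \<in> A" "\<And>j. j \<in> A \<Longrightarrow> V j \<le> V n"
      using obtains_MAX[of A V] by (metis Max_ge empty_iff finite_imageI imageI)
    have max: "V j \<le> V n" for j
      using n unfolding A_def mem_Collect_eq by (meson linear order_trans)
    have Vn: "V n > 0" using max[of k] Vk by simp
    have "V 0 < 0" using W0 h_pos[of 0] e by (simp add: V_def mult_pos_pos add_pos_pos)
         (smt (verit) mult_pos_pos)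
    then have n1: "n \<ge> 1" using Vn by (cases n) auto
    have "harm n = harm (n - 1) + 1 / real n"
      using harm_Suc[of "n - 1", where 'a = real] n1 by (simp add: inverse_eq_divide)
    then have hm: "real n * h (n - 1) = real n * h n - 1"
      using n1 by (simp add: h_def field_simps)
    have "harm (n + 1) = harm n + 1 / real (n + 1)"
      using harm_Suc[of n, where 'a = real] by (simp add: inverse_eq_divide)
    then have hp: "real n * h (n + 1) = real n * h n + real n / real (n + 1)"
      by (simp add: h_def algebra_simps)
    have "p * real n * h (n - 1) + (1 - p) * real n * h (n + 1)
        = p * (real n * h (n - 1)) + (1 - p) * (real n * h (n + 1))" by simp
    also have "\<dots> = real n * h n - p + (1 - p) * (real n / real (n + 1))"
      unfolding hm hp by (simp add: algebra_simps)
    also have "\<dots> \<le> real n * h n + 1"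
    proof -
      have "(1 - p) * (real n / real (n + 1)) \<le> 1 * 1" using p by (intro mult_mono) auto
      then show ?thesis using p by linarith
    qed
    also have "\<dots> \<le> (real n + p) * h n"
      using p harm_nonneg[of n, where 'a = real] by (simp add: h_def field_simps)
    finally have h_super: "p * real n * h (n - 1) + (1 - p) * real n * h (n + 1) \<le> (real n + p) * h n" .
    have "(real n + p) * W n \<le> p * real n * W (n - 1) + (1 - p) * real n * W (n + 1)"
      using sub[OF n1] p by (simp add: balance_def field_simps)
    moreover have "e * (p * real n * h (n - 1) + (1 - p) * real n * h (n + 1)) \<le> e * ((real n + p) * h n)"
      using h_super e by simp
    ultimately have "(real n + p) * V n \<le> p * real n * V (n - 1) + (1 - p) * real n * V (n + 1)"
      by (simp add: V_def algebra_simps)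
    \<comment> \<open>At the maximum both neighbours may be replaced by \<open>V n\<close>. The
      weights on the right add up to \<open>n\<close> only, so the extra \<open>p * V n\<close> on
      the left gives the contradiction.\<close>
    also have "\<dots> \<le> p * real n * V n + (1 - p) * real n * V n"
      using p max by (intro add_mono mult_left_mono) auto
    also have "\<dots> = real n * V n" by (simp add: algebra_simps)
    finally have "p * V n \<le> 0" by (simp add: algebra_simps)
    then show False using p Vn by (simp add: mult_le_0_iff)
  qed
  show ?thesis
  proof (rule field_le_epsilon)
    fix e :: real assume "e > 0"
    then show "W k \<le> 0 + e"
      using key[of "e / h k" k] h_pos[of k] by simp
  qed
qed

lemma limit_sequence_iff:
  "limit_sequence p d \<longleftrightarrow> bounded (range d) \<and> (\<forall>k. d k > 0) \<and> d 0 = (1 - p) / p \<and>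
     (\<forall>k\<ge>1. d k = balance p d k)"
  by (simp add: limit_sequence_def balance_def)

text \<open>The recursion is linear, so the absolute difference of two solutions is a bounded
  subsolution that vanishes at 0, and the maximum principle applies.\<close>

lemma limit_sequence_unique:
  assumes p: "0 < p" "p < 1" and d: "limit_sequence p d" and d': "limit_sequence p d'"
  shows "d' = d"
proof
  fix k
  obtain B B' where B: "\<And>k. \<bar>d k\<bar> \<le> B" "\<And>k. \<bar>d' k\<bar> \<le> B'"
    using d d' by (auto simp: limit_sequence_def bounded_iff)
  have "\<bar>d k - d' k\<bar> \<le> 0"
  proof (rule balance_bounded_subsolution_le_0[OF p, where B = "B + B'"])
    fix k :: nat assume k: "k \<ge> 1"
    have "d k - d' k = balance p (\<lambda>k. d k - d' k) k"
      using d d' k by (simp add: limit_sequence_iff) (simp add: balance_def algebra_simps diff_divide_distrib add_divide_distrib)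
    moreover have "\<dots> \<le> balance p (\<lambda>k. \<bar>d k - d' k\<bar>) k"
      by (intro balance_mono p) simp
    moreover have "- balance p (\<lambda>k. d k - d' k) k = balance p (\<lambda>k. - (d k - d' k)) k"
      by (simp add: balance_def algebra_simps diff_divide_distrib add_divide_distrib)
    moreover have "\<dots> \<le> balance p (\<lambda>k. \<bar>d k - d' k\<bar>) k"
      by (intro balance_mono p) simp
    ultimately show "\<bar>d k - d' k\<bar> \<le> balance p (\<lambda>k. \<bar>d k - d' k\<bar>) k" by linarith
  next
    show "\<bar>d k - d' k\<bar> \<le> B + B'" for k using B(1)[of k] B(2)[of k] by linarith
  qed (use d d' in \<open>simp add: limit_sequence_def\<close>)
  then show "d' k = d k" by simp
qed

text \<open>The constant \<open>(1 - p) / p\<close> is a supersolution and 0 a subsolution, so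
  iterating the monotone operator from 0 increases to a bounded fixed point.\<close>

lemma limit_sequence_exists:
  assumes p: "0 < p" "p < 1"
  shows "\<exists>d. limit_sequence p d"
proof -
  define B where "B = (1 - p) / p"
  \<comment> \<open>The boundary value is built into the operator, so a fixed point satisfies both
    the initial condition and the recursion.\<close>
  define T where "T d k = (if k = 0 then B else balance p d k)" for d k
  have B: "B > 0" using p by (simp add: B_def)
  have T_mono: "T a k \<le> T b k" if "\<And>k. a k \<le> b k" for a b k
    using balance_mono[OF p that] by (simp add: T_def)
  have T_B: "T (\<lambda>_. B) k \<le> B" for k
    using p B by (simp add: T_def balance_def field_simps)
  define s where "s n = (T ^^ n) (\<lambda>_. 0)" for n
  have s_Suc: "s (Suc n) k = T (s n) k" for n k by (simp add: s_def)
  have s_0: "s 0 k = 0" for k by (simp add: s_def)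
  have le_B: "s n k \<le> B" for n k
  proof (induction n arbitrary: k)
    case (Suc n)
    show ?case unfolding s_Suc using T_mono[of "s n" "\<lambda>_. B" k] Suc T_B[of k] by force
  qed (use B in \<open>simp add: s_0\<close>)
  have step: "s n k \<le> s (Suc n) k" for n k
  proof (induction n arbitrary: k)
    case 0
    have "0 \<le> T (\<lambda>_. 0) k" using B by (simp add: T_def balance_def)
    then show ?case by (simp add: s_def)
  next
    case (Suc n)
    show ?case using T_mono[of "s n" "s (Suc n)" k] Suc by (simp add: s_Suc)
  qed
  have inc: "incseq (\<lambda>n. s n k)" for k by (intro incseq_SucI step)
  have "\<exists>l. (\<lambda>n. s n k) \<longlonglongrightarrow> l" for k
    using incseq_convergent[OF inc, of k B] le_B by metis
  then obtain d where d: "\<And>k. (\<lambda>n. s n k) \<longlonglongrightarrow> d k" by metis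
  have fix_eq: "d k = T d k" for k
  proof (rule LIMSEQ_unique)
    show "(\<lambda>n. s (Suc n) k) \<longlonglongrightarrow> d k" using d by (rule LIMSEQ_Suc)
    show "(\<lambda>n. s (Suc n) k) \<longlonglongrightarrow> T d k"
      unfolding s_Suc T_def balance_def using p d by (auto intro!: tendsto_intros)
  qed
  have nonneg: "d k \<ge> 0" for k
    using incseq_le[OF inc d, of 0 k] by (simp add: s_0)
  have upper: "d k \<le> B" for k
    using LIMSEQ_le_const2[OF d, of k B] le_B by blast
  \<comment> \<open>Positivity spreads upwards from \<open>d 0 = B\<close> through the term with
    \<open>d (k - 1)\<close>; for \<open>d (k + 1)\<close> nonnegativity is enough.\<close>
  have pos: "d k > 0" for k
  proof (induction k)
    case (Suc k)
    have "0 < p * real (Suc k) * d k + (1 - p) * real (Suc k) * d (Suc k + 1)"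
      using p Suc nonneg[of "Suc k + 1"] by (intro add_pos_nonneg mult_nonneg_nonneg mult_pos_pos) auto
    then show ?case using fix_eq[of "Suc k"] p by (simp add: T_def balance_def)
  qed (use fix_eq[of 0] B in \<open>simp add: T_def\<close>)
  have "limit_sequence p d"
    unfolding limit_sequence_iff
  proof (intro conjI allI impI)
    show "bounded (range d)"
      using nonneg upper by (intro boundedI[of _ B]) auto
    show "d 0 = (1 - p) / p" using fix_eq[of 0] by (simp add: T_def B_def)
    show "d k = balance p d k" if "k \<ge> 1" for k using fix_eq[of k] that by (simp add: T_def)
  qed (rule pos)
  then show ?thesis by blast
qed

section \<open>Stochastic approximation along a path\<close>

text \<open>With constant input \<open>B\<close> the recursion has the linear solution
  \<open>B / (1 + a) * m\<close>. The excess of \<open>|E m|\<close> over this line is multiplied by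
  at most \<open>1 - a / m\<close>, so it stays bounded above and is negligible after division by
  \<open>m\<close>.\<close>

lemma linear_recursion_eventually_le:
  fixes E c :: "nat \<Rightarrow> real"
  assumes a: "a > 0"
    and rec: "\<And>m. m > 0 \<Longrightarrow> E (Suc m) = E m * (1 - a / real m) + c m"
    and c: "\<forall>\<^sub>F m in sequentially. \<bar>c m\<bar> \<le> B"
    and e: "e > 0"
  shows "\<forall>\<^sub>F m in sequentially. \<bar>E m\<bar> / real m \<le> B / (1 + a) + e"
proof -
  define \<beta> where "\<beta> = B / (1 + a)"
  define u where "u m = \<bar>E m\<bar> - \<beta> * real m" for m
  from c obtain m1 where m1: "\<And>m. m \<ge> m1 \<Longrightarrow> \<bar>c m\<bar> \<le> B" by (auto simp: eventually_sequentially)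
  \<comment> \<open>From \<open>m0\<close> on the input bound holds and \<open>m >= a\<close>, so
    that the factor \<open>1 - a / m\<close> lies between 0 and 1.\<close>
  define m0 where "m0 = max m1 (Suc (nat \<lceil>a\<rceil>))"
  define K where "K = max 0 (u m0)"
  have u_le: "u m \<le> K" if "m \<ge> m0" for m
    using that
  proof (induction m rule: dec_induct)
    case (step m)
    have m: "m > 0" "real m \<ge> a" "m \<ge> m1" using step(1) unfolding m0_def by linarith+
    have q: "0 \<le> 1 - a / real m" "1 - a / real m \<le> 1" using m a by (auto simp: field_simps)
    have "\<bar>E (Suc m)\<bar> \<le> \<bar>E m\<bar> * (1 - a / real m) + B"
      unfolding rec[OF m(1)] using m1[OF m(3)] q(1)
      by (intro order.trans[OF abs_triangle_ineq] add_mono) (auto simp: abs_mult)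
    moreover have "B = \<beta> + \<beta> * real m * (a / real m)"
      using m a by (simp add: \<beta>_def add_divide_distrib[symmetric] nonzero_eq_divide_eq) (simp add: algebra_simps)
    ultimately have "u (Suc m) \<le> u m * (1 - a / real m)"
      unfolding u_def by (simp add: algebra_simps del: times_divide_eq_right times_divide_eq_left)
    also have "\<dots> \<le> K * (1 - a / real m)" using step.IH q by (intro mult_right_mono) auto
    also have "\<dots> \<le> K" using q by (simp add: K_def mult_left_le)
    finally show ?case .
  qed (simp add: K_def)
  have "(\<lambda>m. K / real m) \<longlonglongrightarrow> 0" by (rule lim_const_over_n)
  then have "\<forall>\<^sub>F m in sequentially. K / real m < e" using e by (rule order_tendstoD)
  moreover have "\<forall>\<^sub>F m in sequentially. m \<ge> m0 \<and> m > 0"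
    using eventually_ge_at_top[of m0] eventually_gt_at_top[of 0] by eventually_elim simp
  ultimately show ?thesis
  proof eventually_elim
    case (elim m)
    then have "\<bar>E m\<bar> \<le> K + \<beta> * real m" using u_le[of m] by (simp add: u_def)
    then have "\<bar>E m\<bar> / real m \<le> K / real m + \<beta>" using elim by (simp add: field_simps)
    then show ?case using elim by (simp add: \<beta>_def)
  qed
qed

text \<open>\<open>W\<close> is the limit superior of \<open>f\<close>, obtained as the infimum of
  its eventual upper bounds and so directly as a real number.\<close>

lemma eventual_bound_exists:
  fixes f :: "nat \<Rightarrow> real"
  assumes "\<And>m. 0 \<le> f m" "\<And>m. f m \<le> B"
  obtains W where "0 \<le> W" "W \<le> B" "\<And>e. e > 0 \<Longrightarrow> \<forall>\<^sub>F m in sequentially. f m \<le> W + e"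
    "\<And>c. \<forall>\<^sub>F m in sequentially. f m \<le> c \<Longrightarrow> W \<le> c"
proof
  define S where "S = {c. \<forall>\<^sub>F m in sequentially. f m \<le> c}"
  have B: "B \<in> S" using assms by (simp add: S_def)
  have lower: "0 \<le> c" if "c \<in> S" for c
  proof -
    from that obtain m where "f m \<le> c" by (auto simp: S_def eventually_sequentially)
    then show ?thesis using assms(1)[of m] by simp
  qed
  then have bdd: "bdd_below S" by (rule bdd_belowI)
  show "0 \<le> Inf S" using B lower by (intro cInf_greatest) auto
  show "Inf S \<le> B" using bdd B by (rule cInf_lower2[of B, OF _ order.refl, rotated])
  show "Inf S \<le> c" if "\<forall>\<^sub>F m in sequentially. f m \<le> c" for c
    using bdd that by (intro cInf_lower) (auto simp: S_def)
  show "\<forall>\<^sub>F m in sequentially. f m \<le> Inf S + e" if "e > 0" for e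
  proof -
    from that B bdd obtain c where "c \<in> S" "c < Inf S + e"
      using cInf_less_iff[of S "Inf S + e"] by auto
    then show ?thesis by (auto simp: S_def elim: eventually_mono)
  qed
qed

text \<open>Let \<open>W k\<close> be the limit superior of \<open>|x k m|\<close>. Since
  \<open>N m\<close> grows like \<open>p * m\<close>, the quantity \<open>N m * x k m\<close> obeys,
  up to noise, a recursion with contraction rate \<open>k / p\<close>; its linear growth bound,
  divided by \<open>p\<close>, is exactly \<open>balance p W k\<close>. Hence \<open>W\<close> is a
  bounded subsolution with \<open>W 0 = 0\<close>, and it vanishes.\<close>

lemma relative_deviation_tendsto_0:
  fixes x :: "nat \<Rightarrow> nat \<Rightarrow> real" and N :: "nat \<Rightarrow> real" and \<xi> :: "nat \<Rightarrow> nat \<Rightarrow> real"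
  assumes p: "0 < p" "p < 1"
    and N_pos: "\<And>m. N m > 0"
    and N_lim: "(\<lambda>m. N m / real m) \<longlonglongrightarrow> p"
    and x0: "\<And>m. x 0 m = 0"
    and x_bdd: "\<And>k m. \<bar>x k m\<bar> \<le> B"
    and rec: "\<And>k m. k \<ge> 1 \<Longrightarrow> N (Suc m) * x k (Suc m) = N m * x k m
        + real k * (p * x (k - 1) m + (1 - p) * x (k + 1) m - x k m) + \<xi> k m"
    and noise: "\<And>k. k \<ge> 1 \<Longrightarrow> (\<lambda>m. (\<Sum>i<m. \<xi> k i) / real m) \<longlonglongrightarrow> 0"
  shows "x k \<longlonglongrightarrow> 0"
proof -
  have "\<exists>W. 0 \<le> W \<and> W \<le> B \<and> (\<forall>e>0. \<forall>\<^sub>F m in sequentially. \<bar>x k m\<bar> \<le> W + e) \<and>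
      (\<forall>c. (\<forall>\<^sub>F m in sequentially. \<bar>x k m\<bar> \<le> c) \<longrightarrow> W \<le> c)" for k
    by (rule eventual_bound_exists[of "\<lambda>m. \<bar>x k m\<bar>" B]) (use x_bdd in auto)
  then obtain W where W: "\<And>k. 0 \<le> W k" "\<And>k. W k \<le> B"
    "\<And>k e. e > 0 \<Longrightarrow> \<forall>\<^sub>F m in sequentially. \<bar>x k m\<bar> \<le> W k + e"
    "\<And>k c. \<forall>\<^sub>F m in sequentially. \<bar>x k m\<bar> \<le> c \<Longrightarrow> W k \<le> c" by metis
  have sub: "W k \<le> balance p W k" if k: "k \<ge> 1" for k
  proof (rule field_le_epsilon)
    fix e :: real assume e: "e > 0"
    define a where "a = real k / p"
    have a: "a > 0" using k p by (simp add: a_def)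
    define R where "R m = (\<Sum>i<m. \<xi> k i)" for m
    \<comment> \<open>Removing the accumulated noise leaves a recursion whose input only has to be bounded.\<close>
    define E where "E m = N m * x k m - R m" for m
    \<comment> \<open>The two errors: replacing \<open>N m\<close> by \<open>p * m\<close> in the
      damping term \<open>- k * x k m\<close>, and letting the damping act on \<open>E m\<close>
      instead of \<open>E m + R m\<close>.\<close>
    define \<eta> where "\<eta> m = real k * x k m * (N m / real m / p - 1) - a * (R m / real m)" for m
    define b where "b m = real k * (p * x (k - 1) m + (1 - p) * x (k + 1) m)" for m
    have E_rec: "E (Suc m) = E m * (1 - a / real m) + (b m + \<eta> m)" if "m > 0" for m
      using that p unfolding E_def rec[OF k]
      by (simp add: R_def \<eta>_def b_def a_def field_simps)
    have \<eta>: "\<eta> \<longlonglongrightarrow> 0"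
    proof -
      have "(\<lambda>m. N m / real m / p - 1) \<longlonglongrightarrow> p / p - 1"
        using p by (intro tendsto_intros N_lim) auto
      then have 1: "(\<lambda>m. N m / real m / p - 1) \<longlonglongrightarrow> 0" using p by simp
      have "(\<lambda>m. (real k * x k m) * (N m / real m / p - 1)) \<longlonglongrightarrow> 0"
      proof (rule Lim_null_comparison)
        show "\<forall>\<^sub>F m in sequentially. norm ((real k * x k m) * (N m / real m / p - 1)) \<le> real k * B * \<bar>N m / real m / p - 1\<bar>"
          using x_bdd by (intro always_eventually allI) (auto simp: abs_mult intro!: mult_right_mono mult_left_mono)
        show "(\<lambda>m. real k * B * \<bar>N m / real m / p - 1\<bar>) \<longlonglongrightarrow> 0"
          using tendsto_mult_right_zero[OF tendsto_rabs_zero[OF 1]] by simp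
      qed
      from tendsto_diff[OF this tendsto_mult_right_zero[OF noise[OF k], of a]]
      show ?thesis unfolding \<eta>_def R_def by simp
    qed
    \<comment> \<open>The budget is \<open>k + 4\<close> shares: \<open>k\<close> for the
      neighbours' limits superior, and one each for \<open>\<eta>\<close>, the growth lemma,
      \<open>R m / m\<close>, and the error in \<open>N m / m\<close>. The factor \<open>p\<close>
      anticipates the final division.\<close>
    define e' where "e' = e * p / (real k + 4)"
    have e': "e' > 0" using e p by (simp add: e'_def)
    define c where "c = real k * (p * W (k - 1) + (1 - p) * W (k + 1))"
    have b\<eta>: "\<forall>\<^sub>F m in sequentially. \<bar>b m + \<eta> m\<bar> \<le> c + (real k + 1) * e'"
    proof -
      have "\<forall>\<^sub>F m in sequentially. \<bar>\<eta> m\<bar> < e'"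
        using tendsto_rabs_zero[OF \<eta>] e' by (rule order_tendstoD)
      with W(3)[OF e', of "k - 1"] W(3)[OF e', of "k + 1"] show ?thesis
      proof eventually_elim
        case (elim m)
        have "\<bar>b m\<bar> \<le> real k * (p * \<bar>x (k - 1) m\<bar> + (1 - p) * \<bar>x (k + 1) m\<bar>)"
          unfolding b_def abs_mult using p
          by (auto simp: abs_mult intro!: mult_left_mono order.trans[OF abs_triangle_ineq])
        also have "\<dots> \<le> real k * (p * (W (k - 1) + e') + (1 - p) * (W (k + 1) + e'))"
          using p elim by (intro mult_left_mono add_mono) auto
        also have "\<dots> = c + real k * e'" by (simp add: c_def algebra_simps)
        finally show ?case using elim by (simp add: algebra_simps)
      qed
    qed
    have R: "\<forall>\<^sub>F m in sequentially. \<bar>R m / real m\<bar> < e'"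
      using tendsto_rabs_zero[OF noise[OF k]] e' unfolding R_def by (rule order_tendstoD)
    have "(\<lambda>m. B * \<bar>N m / real m - p\<bar>) \<longlonglongrightarrow> 0"
      using tendsto_mult_right_zero[OF tendsto_rabs_zero[OF LIM_zero[OF N_lim]]] .
    then have N: "\<forall>\<^sub>F m in sequentially. B * \<bar>N m / real m - p\<bar> < e'"
      using e' by (rule order_tendstoD)
    have "\<forall>\<^sub>F m in sequentially. \<bar>x k m\<bar> \<le> (c / (1 + a) + (real k + 4) * e') / p"
      using linear_recursion_eventually_le[OF a E_rec b\<eta> e', simplified] R N eventually_gt_at_top[of 0]
    proof eventually_elim
      case (elim m)
      have "p * x k m = E m / real m + R m / real m - (N m / real m - p) * x k m"
        using elim by (simp add: E_def field_simps)
      then have "p * \<bar>x k m\<bar> = \<bar>E m / real m + R m / real m - (N m / real m - p) * x k m\<bar>"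
        using p by (metis abs_mult abs_of_pos)
      also have "\<dots> \<le> \<bar>E m\<bar> / real m + \<bar>R m / real m\<bar> + \<bar>(N m / real m - p) * x k m\<bar>"
        using abs_triangle_ineq4[of "E m / real m + R m / real m" "(N m / real m - p) * x k m"]
          abs_triangle_ineq[of "E m / real m" "R m / real m"] by (simp add: abs_divide)
      also have "\<bar>(N m / real m - p) * x k m\<bar> \<le> B * \<bar>N m / real m - p\<bar>"
        using mult_left_mono[OF x_bdd[of k m], of "\<bar>N m / real m - p\<bar>"] by (simp add: abs_mult mult.commute)
      also have "\<bar>E m\<bar> / real m \<le> (c + (real k + 1) * e') / (1 + a) + e'" using elim by simp
      also have "(c + (real k + 1) * e') / (1 + a) \<le> c / (1 + a) + (real k + 1) * e'"
        using a e' by (simp add: field_simps)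
      finally have "p * \<bar>x k m\<bar> \<le> c / (1 + a) + (real k + 4) * e'"
        using elim by (simp add: algebra_simps)
      then show ?case using p by (simp add: field_simps)
    qed
    then have "W k \<le> (c / (1 + a) + (real k + 4) * e') / p" by (rule W(4))
    also have "\<dots> = balance p W k + e"
    proof -
      have "c / (1 + a) / p = balance p W k"
        using p k by (simp add: c_def a_def balance_def add_pos_pos algebra_simps)
      moreover have "(real k + 4) * e' / p = e" using p by (simp add: e'_def)
      ultimately show ?thesis by (simp add: add_divide_distrib)
    qed
    finally show "W k \<le> balance p W k + e" .
  qed
  have "W k \<le> 0" for k
  proof (rule balance_bounded_subsolution_le_0[OF p _ W(2) sub])
    show "W 0 \<le> 0" by (rule W(4)) (simp add: x0)
  qed
  then have W0: "W k = 0" for k using W(1)[of k] by (simp add: order.antisym)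
  show "x k \<longlonglongrightarrow> 0"
    unfolding tendsto_iff
  proof (intro allI impI)
    fix e :: real assume "e > 0"
    then have "\<forall>\<^sub>F m in sequentially. \<bar>x k m\<bar> \<le> W k + e / 2" by (intro W(3)) simp
    then show "\<forall>\<^sub>F m in sequentially. dist (x k m) 0 < e"
      by eventually_elim (use \<open>e > 0\<close> W0 in simp)
  qed
qed

section \<open>Disjoint unions of cliques\<close>

text \<open>Symmetry of adjacency is automatic for unordered pairs, so excluding loops and requiring
  transitivity between distinct vertices says that every component is complete. Finiteness and
  non-emptiness make the uniform choice of a vertex meaningful.\<close>

definition clique_graph :: "graph \<Rightarrow> bool" where
  "clique_graph g \<longleftrightarrow> finite (verts g) \<and> verts g \<noteq> {} \<and>
     (\<forall>v. neighbours g v \<subseteq> verts g - {v}) \<and>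
     (\<forall>u v w. u \<in> neighbours g v \<longrightarrow> w \<in> neighbours g u \<longrightarrow> w \<noteq> v \<longrightarrow> w \<in> neighbours g v)"

text \<open>In a \<open>clique_graph\<close> this is the connected component of
  \<open>v\<close>.\<close>

definition clique :: "graph \<Rightarrow> nat \<Rightarrow> nat set" where
  "clique g v = insert v (neighbours g v)"

lemma neighbours_sym: "u \<in> neighbours g v \<longleftrightarrow> v \<in> neighbours g u"
  by (simp add: neighbours_def insert_commute)

lemma neighbours_duplicate:
  "neighbours (duplicate g v) u =
     (let w = Suc (Max (verts g)) in
      neighbours g u \<union> (if u \<in> clique g v then {w} else {}) \<union> (if u = w then clique g v else {}))"
  by (auto simp: neighbours_def duplicate_def clique_def Let_def doubleton_eq_iff image_iff insert_commute)

lemma verts_duplicate: "verts (duplicate g v) = insert (Suc (Max (verts g))) (verts g)"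
  by (simp add: duplicate_def Let_def)

lemma neighbours_isolate: "neighbours (isolate g v) u = (if u = v then {} else neighbours g u - {v})"
  by (auto simp: neighbours_def isolate_def)

lemma verts_isolate: "verts (isolate g v) = verts g"
  by (simp add: isolate_def)

lemma clique_graph_singleton: "clique_graph (Graph {0} {})"
  by (simp add: clique_graph_def neighbours_def)

context
  fixes g assumes g: "clique_graph g"
begin

lemma clique_graph_verts: "finite (verts g)" "verts g \<noteq> {}"
  using g unfolding clique_graph_def by blast+

lemma num_verts_pos: "num_verts g > 0"
  using clique_graph_verts by (simp add: num_verts_def card_gt_0_iff)

lemma new_vertex_notin: "Suc (Max (verts g)) \<notin> verts g"
  using Max_ge[OF clique_graph_verts(1), of "Suc (Max (verts g))"] by auto

lemma neighbours_subset: "neighbours g v \<subseteq> verts g - {v}"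
  using g unfolding clique_graph_def by blast

lemma neighbours_outside:
  assumes "w \<notin> verts g"
  shows "neighbours g w = {}"
proof -
  have "u \<notin> neighbours g w" for u
    using neighbours_subset[of u] neighbours_sym[of u g w] assms by auto
  then show ?thesis by auto
qed

lemma neighbours_trans:
  "u \<in> neighbours g v \<Longrightarrow> w \<in> neighbours g u \<Longrightarrow> w \<noteq> v \<Longrightarrow> w \<in> neighbours g v"
  using g unfolding clique_graph_def by blast

lemma finite_neighbours: "finite (neighbours g v)"
  using neighbours_subset clique_graph_verts(1) by (meson finite_Diff finite_subset)

lemma clique_subset: "v \<in> verts g \<Longrightarrow> clique g v \<subseteq> verts g"
  using neighbours_subset by (auto simp: clique_def)

lemma finite_clique: "finite (clique g v)"
  using finite_neighbours by (simp add: clique_def)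

lemma card_clique: "card (clique g v) = Suc (degree g v)"
proof -
  have "v \<notin> neighbours g v" using neighbours_subset[of v] by blast
  then show ?thesis using finite_neighbours[of v] by (simp add: clique_def degree_def)
qed

text \<open>By symmetry and transitivity a component looks the same from each of its vertices; in
  particular the degree is constant on it.\<close>

lemma neighbours_eq_clique: "u \<in> clique g v \<Longrightarrow> neighbours g u = clique g v - {u}"
  unfolding clique_def using neighbours_sym neighbours_trans neighbours_subset by blast

lemma degree_clique: "u \<in> clique g v \<Longrightarrow> degree g u = degree g v"
  using card_clique[of v] finite_clique[of v] by (simp add: degree_def[of g u] neighbours_eq_clique)

text \<open>The new vertex is joined to all of the clique of \<open>v\<close> and to nothing else,
  so that one clique grows by a vertex and the other components are untouched.\<close>

lemma clique_graph_duplicate: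
  assumes v: "v \<in> verts g"
  shows "clique_graph (duplicate g v)"
proof -
  define w where "w = Suc (Max (verts g))"
  have w: "w \<notin> verts g" using new_vertex_notin by (simp add: w_def)
  have nw: "neighbours g w = {}" using w by (rule neighbours_outside)
  have nb: "neighbours (duplicate g v) u =
      (if u = w then clique g v else if u \<in> clique g v then insert w (clique g v - {u}) else neighbours g u)" for u
    using w nw clique_subset[OF v] by (auto simp: neighbours_duplicate w_def[symmetric] Let_def neighbours_eq_clique)
  have disj: "x \<notin> clique g v" if "u \<notin> clique g v" "x \<in> neighbours g u" for u x
    using that neighbours_eq_clique[of x v] by (metis Diff_iff neighbours_sym)
  show ?thesis
    unfolding clique_graph_def
  proof (intro conjI allI impI)
    show "finite (verts (duplicate g v))" "verts (duplicate g v) \<noteq> {}"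
      using clique_graph_verts by (auto simp: verts_duplicate)
    show "neighbours (duplicate g v) u \<subseteq> verts (duplicate g v) - {u}" for u
      using w clique_subset[OF v] neighbours_subset[of u]
      by (auto simp: nb verts_duplicate w_def[symmetric])
    show "z \<in> neighbours (duplicate g v) x"
      if "u \<in> neighbours (duplicate g v) x" "z \<in> neighbours (duplicate g v) u" "z \<noteq> x" for u x z
    proof -
      have sub: "y \<noteq> w" if "y \<in> clique g v" for y using that w clique_subset[OF v] by blast
      have nw': "w \<notin> neighbours g y" for y using w neighbours_subset[of y] by blast
      show ?thesis
        using that sub nw' disj[of x u] disj[of u z] neighbours_trans[of u x z] neighbours_sym[of u g x]
        by (simp add: nb split: if_splits) metis
    qed
  qed
qed

lemma clique_graph_isolate: "clique_graph (isolate g v)"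
  unfolding clique_graph_def
proof (intro conjI allI impI)
  show "finite (verts (isolate g v))" "verts (isolate g v) \<noteq> {}"
    using clique_graph_verts by (simp_all add: verts_isolate)
  show "neighbours (isolate g v) u \<subseteq> verts (isolate g v) - {u}" for u
    using neighbours_subset[of u] by (auto simp: verts_isolate neighbours_isolate)
  show "z \<in> neighbours (isolate g v) x"
    if "u \<in> neighbours (isolate g v) x" "z \<in> neighbours (isolate g v) u" "z \<noteq> x" for u x z
    using that neighbours_trans[of u x z] by (simp add: neighbours_isolate split: if_splits)
qed

section \<open>Effect of one step on degrees and class counts\<close>

lemma num_verts_duplicate: "num_verts (duplicate g v) = num_verts g + 1"
  using clique_graph_verts new_vertex_notin by (simp add: num_verts_def verts_duplicate)

lemma num_verts_isolate: "num_verts (isolate g v) = num_verts g"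
  by (simp add: num_verts_def verts_isolate)

lemma degree_duplicate:
  assumes v: "v \<in> verts g" and u: "u \<in> verts (duplicate g v)"
  shows "degree (duplicate g v) u =
    (if u \<in> clique g v \<or> u = Suc (Max (verts g)) then Suc (degree g v) else degree g u)"
proof -
  define w where "w = Suc (Max (verts g))"
  have w: "w \<notin> verts g" using new_vertex_notin by (simp add: w_def)
  have nw: "neighbours g w = {}" using w by (rule neighbours_outside)
  have "neighbours (duplicate g v) u =
     (if u = w then clique g v else if u \<in> clique g v then insert w (neighbours g u) else neighbours g u)"
    using w nw clique_subset[OF v] by (auto simp: neighbours_duplicate w_def[symmetric] Let_def)
  moreover have "w \<notin> neighbours g u" using neighbours_subset[of u] w by auto
  ultimately show ?thesis
    using card_clique[of v] finite_neighbours degree_clique[of u v]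
    by (auto simp: degree_def[of "duplicate g v"] w_def[symmetric]) (auto simp: degree_def)
qed

lemma degree_isolate:
  "degree (isolate g v) u =
    (if u = v then 0 else if u \<in> clique g v then degree g v - 1 else degree g u)"
proof -
  have "neighbours g u - {v} = neighbours g u" if "u \<notin> clique g v"
    using that neighbours_sym[of u g v] by (auto simp: clique_def)
  moreover have "v \<in> neighbours g u" if "u \<in> clique g v" "u \<noteq> v"
    using that neighbours_sym[of u g v] by (auto simp: clique_def)
  ultimately show ?thesis
    using finite_neighbours degree_clique[of u v]
    by (auto simp: degree_def[of "isolate g v"] neighbours_isolate) (auto simp: degree_def)
qed

text \<open>Among the old vertices, a step at \<open>v\<close> changes degrees only inside the
  clique of \<open>v\<close>. Its contribution is all or nothing because the degree is constant
  there, and \<open>Suc j\<close> is the clique size at degree \<open>j\<close>.\<close>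

lemma num_verts_of_degree_split:
  assumes v: "v \<in> verts g"
  shows "num_verts_of_degree j g = card {u \<in> verts g - clique g v. degree g u = j}
    + (if degree g v = j then Suc j else 0)"
proof -
  have "{u \<in> verts g. degree g u = j} = {u \<in> verts g - clique g v. degree g u = j}
     \<union> {u \<in> clique g v. degree g u = j}"
    using clique_subset[OF v] by auto
  moreover have "{u \<in> clique g v. degree g u = j} = (if degree g v = j then clique g v else {})"
    using degree_clique[of _ v] by auto
  ultimately have "num_verts_of_degree j g = card ({u \<in> verts g - clique g v. degree g u = j}
     \<union> (if degree g v = j then clique g v else {}))" by (simp add: num_verts_of_degree_def)
  also have "\<dots> = card {u \<in> verts g - clique g v. degree g u = j} + card (if degree g v = j then clique g v else {})"
    using clique_graph_verts finite_clique by (intro card_Un_disjoint) auto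
  finally show ?thesis by (auto simp: card_clique)
qed

lemma num_verts_of_degree_duplicate:
  assumes v: "v \<in> verts g"
  shows "real (num_verts_of_degree j (duplicate g v)) = real (num_verts_of_degree j g)
    - (if degree g v = j then real (Suc j) else 0) + (if Suc (degree g v) = j then real (Suc j) else 0)"
proof -
  define w where "w = Suc (Max (verts g))"
  have w: "w \<notin> verts g" using new_vertex_notin by (simp add: w_def)
  define C where "C = insert w (clique g v)"
  have "w \<notin> clique g v" using clique_subset[OF v] w by blast
  then have C: "finite C" "card C = Suc (Suc (degree g v))"
    using finite_clique[of v] card_clique[of v] by (simp_all add: C_def)
  have "{u \<in> verts (duplicate g v). degree (duplicate g v) u = j} =
      {u \<in> verts g - clique g v. degree g u = j} \<union> (if Suc (degree g v) = j then C else {})"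
    using clique_subset[OF v] w
    by (auto simp: degree_duplicate[OF v] verts_duplicate C_def w_def[symmetric])
  then have "num_verts_of_degree j (duplicate g v) =
      card ({u \<in> verts g - clique g v. degree g u = j} \<union> (if Suc (degree g v) = j then C else {}))"
    by (simp add: num_verts_of_degree_def)
  also have "\<dots> = card {u \<in> verts g - clique g v. degree g u = j} + card (if Suc (degree g v) = j then C else {})"
    using clique_graph_verts C w by (intro card_Un_disjoint) (auto simp: C_def)
  finally show ?thesis
    using num_verts_of_degree_split[OF v, of j] C by auto
qed

text \<open>The last summand counts \<open>v\<close> itself after the deletion. If \<open>v\<close>
  was isolated already, it cancels the loss recorded for \<open>j = 0\<close>, as it should.\<close>

lemma num_verts_of_degree_isolate:
  assumes v: "v \<in> verts g"
  shows "real (num_verts_of_degree j (isolate g v)) = real (num_verts_of_degree j g)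
    - (if degree g v = j then real (Suc j) else 0) + (if degree g v = Suc j then real (Suc j) else 0)
    + (if j = 0 then 1 else 0)"
proof -
  define C where "C = neighbours g v"
  have C: "finite C" "card C = degree g v" "v \<notin> C"
    using finite_neighbours neighbours_subset[of v] by (auto simp: C_def degree_def)
  have cl: "clique g v = insert v C" by (simp add: clique_def C_def)
  \<comment> \<open>The truncated \<open>degree g v - 1\<close> does no harm: when the degree is 0
    the remainder \<open>C\<close> is empty.\<close>
  have "{u \<in> verts (isolate g v). degree (isolate g v) u = j} =
      {u \<in> verts g - clique g v. degree g u = j} \<union>
      ((if degree g v - 1 = j then C else {}) \<union> (if j = 0 then {v} else {}))"
    using clique_subset[OF v] v C by (auto simp: degree_isolate verts_isolate cl)
  then have "num_verts_of_degree j (isolate g v) =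
      card ({u \<in> verts g - clique g v. degree g u = j} \<union>
      ((if degree g v - 1 = j then C else {}) \<union> (if j = 0 then {v} else {})))"
    by (simp add: num_verts_of_degree_def)
  also have "\<dots> = card {u \<in> verts g - clique g v. degree g u = j} +
      (card (if degree g v - 1 = j then C else {}) + card (if j = 0 then {v} else {}))"
    using clique_graph_verts C by (subst card_Un_disjoint card_Un_disjoint) (auto simp: cl card_Un_disjoint)
  finally show ?thesis
    using num_verts_of_degree_split[OF v, of j] C by (cases "degree g v") auto
qed

end

section \<open>Conditional means and jump sizes of one transition\<close>

lemma set_dd_step:
  assumes "clique_graph g" "g' \<in> set_pmf (dd_step p g)"
  shows "\<exists>v\<in>verts g. g' = duplicate g v \<or> g' = isolate g v"
  using assms clique_graph_verts[OF assms(1)] by (auto simp: dd_step_def split: if_splits)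

lemma finite_set_dd_step:
  assumes "clique_graph g"
  shows "finite (set_pmf (dd_step p g))"
  using clique_graph_verts[OF assms] by (auto simp: dd_step_def)

lemma clique_graph_step:
  assumes "clique_graph g" "g' \<in> set_pmf (dd_step p g)"
  shows "clique_graph g'"
  using set_dd_step[OF assms] clique_graph_duplicate[OF assms(1)] clique_graph_isolate[OF assms(1)] by blast

lemma expectation_dd_step:
  fixes F :: "graph \<Rightarrow> real"
  assumes p: "0 < p" "p < 1" and g: "clique_graph g"
  shows "measure_pmf.expectation (dd_step p g) F =
    (\<Sum>v\<in>verts g. p * F (duplicate g v) + (1 - p) * F (isolate g v)) / real (num_verts g)"
proof -
  have "measure_pmf.expectation (dd_step p g) F =
     (\<Sum>b\<in>UNIV. pmf (bernoulli_pmf p) b *\<^sub>R measure_pmf.expectation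
        (map_pmf (if b then duplicate g else isolate g) (pmf_of_set (verts g))) F)"
    unfolding dd_step_def using clique_graph_verts[OF g] by (intro pmf_expectation_bind) auto
  also have "\<dots> = p * ((\<Sum>v\<in>verts g. F (duplicate g v)) / real (num_verts g))
      + (1 - p) * ((\<Sum>v\<in>verts g. F (isolate g v)) / real (num_verts g))"
    using p clique_graph_verts[OF g] by (simp add: UNIV_bool integral_pmf_of_set num_verts_def)
  finally show ?thesis
    by (simp add: sum.distrib sum_distrib_left add_divide_distrib)
qed

lemma expectation_num_verts:
  assumes p: "0 < p" "p < 1" and g: "clique_graph g"
  shows "measure_pmf.expectation (dd_step p g) (\<lambda>g. real (num_verts g)) = real (num_verts g) + p"
  using num_verts_pos[OF g]
  by (simp add: expectation_dd_step[OF assms] num_verts_duplicate[OF g] num_verts_isolate[OF g]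
      num_verts_def[symmetric] field_simps)

text \<open>Class 0 is fictitious, of size \<open>d\<^sub>0\<close> times the number of vertices: its contribution \<open>p d\<^sub>0 = 1 - p\<close>
  to the drift of class 1 accounts for the isolated vertex that every deletion step leaves behind.\<close>

definition class_size :: "real \<Rightarrow> nat \<Rightarrow> graph \<Rightarrow> real" where
  "class_size p k g = (if k = 0 then (1 - p) / p * real (num_verts g) else real (num_verts_of_degree (k - 1) g))"

lemma sum_if_degree:
  assumes "clique_graph g"
  shows "(\<Sum>v\<in>verts g. if degree g v = j then c else (0::real)) = c * real (num_verts_of_degree j g)"
  using clique_graph_verts[OF assms]
  by (simp add: sum.If_cases num_verts_of_degree_def Int_def)

text \<open>A uniform vertex lies in a given class with probability class size over
  \<open>num_verts g\<close>, and each hit moves a whole clique, carrying \<open>k\<close> vertices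
  into or out of class \<open>k\<close>. Both step types empty class \<open>k\<close>, so the
  outflow has total weight \<open>p + (1 - p) = 1\<close>.\<close>

lemma expectation_class_size:
  assumes p: "0 < p" "p < 1" and g: "clique_graph g" and k: "k \<ge> 1"
  shows "measure_pmf.expectation (dd_step p g) (class_size p k) = class_size p k g
    + real k * (p * class_size p (k - 1) g + (1 - p) * class_size p (k + 1) g - class_size p k g) / real (num_verts g)"
proof -
  obtain j where j: "k = Suc j" using k by (cases k) auto
  have N: "real (num_verts g) > 0" using num_verts_pos[OF g] by simp
  let ?D = "\<lambda>i. real (num_verts_of_degree i g)"
  have "(\<Sum>v\<in>verts g. p * class_size p k (duplicate g v) + (1 - p) * class_size p k (isolate g v)) =
     (\<Sum>v\<in>verts g. ?D j - (if degree g v = j then real k else 0)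
        + p * (if Suc (degree g v) = j then real k else 0)
        + (1 - p) * (if degree g v = Suc j then real k else 0) + (1 - p) * (if j = 0 then 1 else 0))"
    by (intro sum.cong refl)
       (simp add: class_size_def j num_verts_of_degree_duplicate[OF g] num_verts_of_degree_isolate[OF g] algebra_simps)
  also have "\<dots> = real (num_verts g) * ?D j - real k * ?D j
      + p * (\<Sum>v\<in>verts g. if Suc (degree g v) = j then real k else 0)
      + (1 - p) * (real k * ?D (Suc j)) + real (num_verts g) * ((1 - p) * (if j = 0 then 1 else 0))"
    by (simp add: sum.distrib sum_subtractf sum_distrib_left[symmetric] sum_if_degree[OF g] num_verts_def)
  also have "(\<Sum>v\<in>verts g. if Suc (degree g v) = j then real k else 0) = (if j = 0 then 0 else real k * ?D (j - 1))"
    using sum_if_degree[OF g, of "j - 1" "real k"] by (cases j) auto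
  \<comment> \<open>For \<open>j = 0\<close> no clique can grow into size 1; the vertices isolated
    by deletions take the place of this inflow, and they match \<open>p\<close> times the fictitious
    class 0.\<close>
  also have "real (num_verts g) * ?D j - real k * ?D j
      + p * (if j = 0 then 0 else real k * ?D (j - 1))
      + (1 - p) * (real k * ?D (Suc j)) + real (num_verts g) * ((1 - p) * (if j = 0 then 1 else 0))
    = real (num_verts g) * class_size p k g
      + real k * (p * class_size p (k - 1) g + (1 - p) * class_size p (k + 1) g - class_size p k g)"
    using p by (cases "j = 0") (simp_all add: class_size_def j diff_divide_distrib algebra_simps)
  finally show ?thesis
    unfolding expectation_dd_step[OF p g] using N by (simp add: add_divide_distrib)
qed

text \<open>The gain and the loss of a clique exclude each other, so at most \<open>k\<close>
  vertices move, plus the single vertex isolated by a deletion. The bound does not depend on the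
  size of the graph.\<close>

lemma class_size_step:
  assumes g: "clique_graph g" and k: "k \<ge> 1" and g': "g' \<in> set_pmf (dd_step p g)"
  shows "\<bar>class_size p k g' - class_size p k g\<bar> \<le> real k + 1"
proof -
  obtain j where j: "k = Suc j" using k by (cases k) auto
  obtain v where v: "v \<in> verts g" "g' = duplicate g v \<or> g' = isolate g v"
    using set_dd_step[OF g g'] by blast
  from v(2) show ?thesis
  proof
    assume "g' = duplicate g v"
    then show ?thesis by (simp add: class_size_def j num_verts_of_degree_duplicate[OF g v(1)])
  next
    assume "g' = isolate g v"
    then show ?thesis by (simp add: class_size_def j num_verts_of_degree_isolate[OF g v(1)])
  qed
qed

lemma num_verts_step:
  assumes g: "clique_graph g" and g': "g' \<in> set_pmf (dd_step p g)"
  shows "\<bar>real (num_verts g') - real (num_verts g)\<bar> \<le> 1"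
proof -
  obtain v where "g' = duplicate g v \<or> g' = isolate g v" using set_dd_step[OF assms] by blast
  then show ?thesis using num_verts_duplicate[OF g, of v] num_verts_isolate[OF g, of v] by auto
qed

lemma class_size_bounds:
  assumes g: "clique_graph g" and k: "k \<ge> 1"
  shows "0 \<le> class_size p k g" "class_size p k g \<le> real (num_verts g)"
  using k clique_graph_verts[OF g]
  by (simp_all add: class_size_def num_verts_of_degree_def num_verts_def card_mono)

section \<open>Martingale noise\<close>

text \<open>From \<open>n^2\<close> to any \<open>m\<close> before the next square there are at most
  \<open>2 * n\<close> steps, so \<open>a\<close> changes by at most \<open>2 * n * K\<close>, which
  is negligible against \<open>n^2\<close>.\<close>

lemma sparse_average_tendsto_0:
  fixes a :: "nat \<Rightarrow> real"
  assumes inc: "\<And>m. \<bar>a (Suc m) - a m\<bar> \<le> K"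
    and sub: "(\<lambda>n. a (n\<^sup>2) / real (n\<^sup>2)) \<longlonglongrightarrow> 0"
  shows "(\<lambda>m. a m / real m) \<longlonglongrightarrow> 0"
proof -
  have inc': "\<bar>a (m + i) - a m\<bar> \<le> K * real i" for m i
  proof (induction i)
    case (Suc i)
    show ?case using Suc inc[of "m + i"] by (simp add: algebra_simps)
  qed simp
  have K: "K \<ge> 0" using inc[of 0] by linarith
  define t where "t n = \<bar>a (n\<^sup>2) / real (n\<^sup>2)\<bar> + 2 * K / real n" for n
  have "t \<longlonglongrightarrow> \<bar>0\<bar> + 0"
    unfolding t_def by (intro tendsto_add tendsto_rabs sub lim_const_over_n)
  moreover have "filterlim floor_sqrt at_top sequentially"
    unfolding filterlim_at_top eventually_sequentially using le_floor_sqrtI by blast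
  ultimately have "(\<lambda>m. t (floor_sqrt m)) \<longlonglongrightarrow> 0"
    using filterlim_compose by force
  moreover have "\<forall>\<^sub>F m in sequentially. norm (a m / real m) \<le> t (floor_sqrt m)"
    using eventually_gt_at_top[of 0]
  proof eventually_elim
    case (elim m)
    define n where "n = floor_sqrt m"
    have n: "n > 0" "n\<^sup>2 \<le> m" "m < (Suc n)\<^sup>2"
      using elim Suc_floor_sqrt_power2_gt by (auto simp: n_def)
    define i where "i = m - n\<^sup>2"
    have i: "m = n\<^sup>2 + i" "i \<le> 2 * n"
      using n by (simp_all add: i_def power2_eq_square)
    have "\<bar>a m\<bar> \<le> \<bar>a (n\<^sup>2)\<bar> + K * real (2 * n)"
    proof -
      have "K * real i \<le> K * real (2 * n)" using K i by (intro mult_left_mono) auto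
      then show ?thesis using inc'[of "n\<^sup>2" i, folded i(1)] by linarith
    qed
    then have "\<bar>a m\<bar> / real m \<le> (\<bar>a (n\<^sup>2)\<bar> + K * real (2 * n)) / real m"
      by (intro divide_right_mono) auto
    also have "\<dots> \<le> (\<bar>a (n\<^sup>2)\<bar> + K * real (2 * n)) / real (n\<^sup>2)"
      using n K elim by (intro divide_left_mono mult_pos_pos add_nonneg_nonneg) (auto simp del: of_nat_power)
    also have "\<dots> = t n" using n by (simp add: t_def field_simps power2_eq_square)
    finally show ?case by (simp add: n_def)
  qed
  ultimately show ?thesis by (rule Lim_null_comparison[rotated])
qed

text \<open>Along the squares the second moment of \<open>X m / m\<close> is at most
  \<open>C / n^2\<close>, which is summable, so convergence holds there almost surely; bounded
  increments fill the gaps.\<close>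

lemma (in prob_space) AE_average_tendsto_0:
  fixes X :: "nat \<Rightarrow> 'a \<Rightarrow> real"
  assumes X[measurable]: "\<And>m. X m \<in> borel_measurable M"
    and sq: "\<And>m. integrable M (\<lambda>\<omega>. (X m \<omega>)\<^sup>2)"
    and var: "\<And>m. expectation (\<lambda>\<omega>. (X m \<omega>)\<^sup>2) \<le> C * real m"
    and inc: "\<And>m. AE \<omega> in M. \<bar>X (Suc m) \<omega> - X m \<omega>\<bar> \<le> K"
  shows "AE \<omega> in M. (\<lambda>m. X m \<omega> / real m) \<longlonglongrightarrow> 0"
proof -
  define q where "q n \<omega> = (X ((Suc n)\<^sup>2) \<omega> / real ((Suc n)\<^sup>2))\<^sup>2" for n \<omega>
  have C: "C \<ge> 0"
  proof -
    have "0 \<le> expectation (\<lambda>\<omega>. (X 1 \<omega>)\<^sup>2)" by simp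
    also have "\<dots> \<le> C" using var[of 1] by simp
    finally show ?thesis .
  qed
  have q_int: "(\<integral>\<^sup>+\<omega>. ennreal (q n \<omega>) \<partial>M) \<le> ennreal (C * inverse ((real (Suc n))\<^sup>2))" for n
  proof -
    define s where "s = real ((Suc n)\<^sup>2)"
    have s: "s > 0" by (simp add: s_def)
    have qs: "q n = (\<lambda>\<omega>. (X ((Suc n)\<^sup>2) \<omega>)\<^sup>2 / s\<^sup>2)"
      by (simp add: fun_eq_iff q_def s_def power_divide)
    have "(\<integral>\<^sup>+\<omega>. ennreal (q n \<omega>) \<partial>M) = ennreal (expectation (q n))"
      unfolding qs using sq by (intro nn_integral_eq_integral integrable_divide) auto
    also have "expectation (q n) = expectation (\<lambda>\<omega>. (X ((Suc n)\<^sup>2) \<omega>)\<^sup>2) / s\<^sup>2"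
      by (simp add: qs)
    also have "\<dots> \<le> C * s / s\<^sup>2"
      using var[of "(Suc n)\<^sup>2"] s unfolding s_def by (intro divide_right_mono) auto
    also have "C * s / s\<^sup>2 = C * inverse ((real (Suc n))\<^sup>2)"
    proof -
      have "C * s / s\<^sup>2 = C * inverse s" using s by (simp add: power2_eq_square field_simps)
      then show ?thesis by (simp add: s_def)
    qed
    finally show ?thesis by (simp add: ennreal_leI)
  qed
  have "summable (\<lambda>n. C * inverse ((real (Suc n))\<^sup>2))"
    using inverse_power_summable[of 2, where 'a = real] by (intro summable_mult) (subst summable_Suc_iff, simp)
  then have fin: "(\<Sum>n. ennreal (C * inverse ((real (Suc n))\<^sup>2))) \<noteq> top"
    using C by (intro ennreal_suminf_neq_top) auto
  \<comment> \<open>Exchanging sum and integral shows that the random series of squares has finite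
    mean. It is therefore almost surely finite and its terms tend to 0.\<close>
  have "(\<integral>\<^sup>+\<omega>. (\<Sum>n. ennreal (q n \<omega>)) \<partial>M) = (\<Sum>n. \<integral>\<^sup>+\<omega>. ennreal (q n \<omega>) \<partial>M)"
    by (intro nn_integral_suminf) (simp add: q_def)
  also have "\<dots> \<le> (\<Sum>n. ennreal (C * inverse ((real (Suc n))\<^sup>2)))"
    by (intro suminf_le q_int) auto
  finally have "(\<integral>\<^sup>+\<omega>. (\<Sum>n. ennreal (q n \<omega>)) \<partial>M) \<noteq> \<infinity>"
    using fin by (auto simp: top_unique)
  then have "AE \<omega> in M. (\<Sum>n. ennreal (q n \<omega>)) \<noteq> \<infinity>"
    by (intro nn_integral_PInf_AE) (simp_all add: q_def)
  moreover have "AE \<omega> in M. \<forall>m. \<bar>X (Suc m) \<omega> - X m \<omega>\<bar> \<le> K"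
    using inc by (simp add: AE_all_countable)
  ultimately show ?thesis
  proof eventually_elim
    case (elim \<omega>)
    have "summable (\<lambda>n. q n \<omega>)"
      using elim(1) by (intro summable_suminf_not_top) (auto simp: q_def)
    then have "(\<lambda>n. q n \<omega>) \<longlonglongrightarrow> 0" by (rule summable_LIMSEQ_zero)
    then have "(\<lambda>n. sqrt (q n \<omega>)) \<longlonglongrightarrow> sqrt 0" by (rule tendsto_real_sqrt)
    then have "(\<lambda>n. X ((Suc n)\<^sup>2) \<omega> / real ((Suc n)\<^sup>2)) \<longlonglongrightarrow> 0"
      unfolding q_def real_sqrt_abs real_sqrt_zero tendsto_rabs_zero_iff .
    then have "(\<lambda>n. X (n\<^sup>2) \<omega> / real (n\<^sup>2)) \<longlonglongrightarrow> 0" by (rule LIMSEQ_imp_Suc)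
    with elim(2) show ?case by (intro sparse_average_tendsto_0) auto
  qed
qed

section \<open>Reachable states, pasts, and martingale increments\<close>

primrec reachable :: "real \<Rightarrow> nat \<Rightarrow> graph set" where
  "reachable p 0 = {Graph {0} {}}"
| "reachable p (Suc m) = (\<Union>g\<in>reachable p m. set_pmf (dd_step p g))"

lemma reachable_clique_graph: "g \<in> reachable p m \<Longrightarrow> clique_graph g"
  by (induction m arbitrary: g) (auto simp: clique_graph_singleton intro: clique_graph_step)

lemma finite_reachable: "finite (reachable p m)"
  by (induction m) (auto intro: finite_set_dd_step reachable_clique_graph)

context dd_process
begin

definition path_event :: "nat \<Rightarrow> (nat \<Rightarrow> graph) \<Rightarrow> 'w set" where
  "path_event m h = {\<omega> \<in> space M. \<forall>i\<le>m. G i \<omega> = h i}"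

definition step_event :: "nat \<Rightarrow> (nat \<Rightarrow> graph) \<Rightarrow> graph \<Rightarrow> 'w set" where
  "step_event m h g = {\<omega> \<in> space M. (\<forall>i\<le>m. G i \<omega> = h i) \<and> G (Suc m) \<omega> = g}"

text \<open>Extensional functions give each past up to time \<open>m\<close> exactly one
  representative. There are finitely many, so conditioning on the past reduces to a finite sum over
  path events.\<close>

definition paths :: "nat \<Rightarrow> (nat \<Rightarrow> graph) set" where
  "paths m = (\<Pi>\<^sub>E i\<in>{..m}. reachable p i)"

text \<open>The martingale increment in the Doob decomposition of \<open>F\<close> along the chain:
  the observed value minus its conditional mean given the past.\<close>

definition noise :: "(graph \<Rightarrow> real) \<Rightarrow> nat \<Rightarrow> 'w \<Rightarrow> real" where
  "noise F m \<omega> = F (G (Suc m) \<omega>) - measure_pmf.expectation (dd_step p (G m \<omega>)) F"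

lemma measurable_fun_G [measurable]: "(\<lambda>\<omega>. F (G m \<omega>) :: real) \<in> borel_measurable M"
  by (rule measurable_compose[OF measurable_G]) simp

lemma measurable_noise [measurable]: "noise F m \<in> borel_measurable M"
  unfolding noise_def
  using measurable_fun_G[of "\<lambda>g. measure_pmf.expectation (dd_step p g) F"] by measurable

lemma G_eq_event [measurable]: "{\<omega> \<in> space M. G m \<omega> = g} \<in> events"
  using measurable_sets[OF measurable_G, of "{g}" m] by (simp add: vimage_def Int_def conj_commute)

lemma path_event_sets [measurable]: "path_event m h \<in> events"
proof -
  have "path_event m h = (\<Inter>i\<in>{..m}. {\<omega> \<in> space M. G i \<omega> = h i})"
    by (auto simp: path_event_def)
  then show ?thesis by (simp only:) (intro sets.finite_INT G_eq_event; simp)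
qed

lemma step_event_eq: "step_event m h g = path_event m h \<inter> {\<omega> \<in> space M. G (Suc m) \<omega> = g}"
  by (auto simp: step_event_def path_event_def)

lemma step_event_sets [measurable]: "step_event m h g \<in> events"
  unfolding step_event_eq by measurable

lemma prob_step_event: "prob (step_event m h g) = prob (path_event m h) * pmf (dd_step p (h m)) g"
  using transition by (simp add: step_event_def path_event_def)

text \<open>The transition law prescribes the probability of each single successor. Summed over the
  finite support these exhaust the probability of the past, so any other successor has probability
  0.\<close>

lemma AE_step:
  assumes fin: "finite (set_pmf (dd_step p (h m)))"
  shows "AE \<omega> in M. \<omega> \<in> path_event m h \<longrightarrow> G (Suc m) \<omega> \<in> set_pmf (dd_step p (h m))"
proof -
  define S where "S = set_pmf (dd_step p (h m))"
  define A where "A = (\<Union>g\<in>S. step_event m h g)"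
  have A: "A \<in> events" unfolding A_def using fin by (auto simp: S_def)
  have sub: "A \<subseteq> path_event m h" by (auto simp: A_def step_event_eq)
  have "prob A = (\<Sum>g\<in>S. prob (step_event m h g))"
    unfolding A_def using fin
    by (intro finite_measure_finite_Union) (auto simp: S_def disjoint_family_on_def step_event_eq)
  also have "\<dots> = prob (path_event m h)"
    using fin by (simp add: prob_step_event sum_distrib_left[symmetric] S_def sum_pmf_eq_1)
  finally have "prob (path_event m h - A) = 0"
    using A sub by (simp add: finite_measure_Diff)
  then have "path_event m h - A \<in> null_sets M"
    using A by (simp add: null_sets_def emeasure_eq_measure)
  then have "AE \<omega> in M. \<omega> \<notin> path_event m h - A" by (rule AE_not_in)
  then show ?thesis by eventually_elim (auto simp: A_def step_event_eq S_def)
qed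

lemma finite_paths: "finite (paths m)"
  unfolding paths_def by (intro finite_PiE) (auto simp: finite_reachable)

lemma paths_clique_graph: "h \<in> paths m \<Longrightarrow> clique_graph (h m)"
  by (auto simp: paths_def intro: reachable_clique_graph)

lemma path_of_reachable:
  assumes "\<omega> \<in> space M" "\<forall>i\<le>m. G i \<omega> \<in> reachable p i"
  shows "restrict (\<lambda>i. G i \<omega>) {..m} \<in> paths m" "\<omega> \<in> path_event m (restrict (\<lambda>i. G i \<omega>) {..m})"
  using assms by (auto simp: paths_def path_event_def)

lemma AE_reachable_upto: "AE \<omega> in M. \<forall>i\<le>m. G i \<omega> \<in> reachable p i"
proof (induction m)
  case 0
  show ?case using initial by simp
next
  case (Suc m)
  have "AE \<omega> in M. \<forall>h\<in>paths m. \<omega> \<in> path_event m h \<longrightarrow> G (Suc m) \<omega> \<in> set_pmf (dd_step p (h m))"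
    by (intro AE_finite_allI finite_paths AE_step finite_set_dd_step paths_clique_graph)
  with Suc AE_space show ?case
  proof eventually_elim
    case (elim \<omega>)
    then have "G (Suc m) \<omega> \<in> set_pmf (dd_step p (G m \<omega>))"
      using path_of_reachable[of \<omega> m] by fastforce
    then show ?case using elim by (auto simp: le_Suc_eq)
  qed
qed

lemma AE_reachable: "AE \<omega> in M. \<forall>m. G m \<omega> \<in> reachable p m"
  using AE_reachable_upto by (simp add: AE_all_countable) (meson AE_mp AE_I2 order.refl)

text \<open>This is the almost sure event on which the later pathwise arguments run: every state is
  a clique graph and every transition is admissible.\<close>

lemma AE_path:
  "AE \<omega> in M. \<forall>m. G m \<omega> \<in> reachable p m \<and> G (Suc m) \<omega> \<in> set_pmf (dd_step p (G m \<omega>))"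
proof -
  have "AE \<omega> in M. \<forall>m. \<forall>h\<in>paths m. \<omega> \<in> path_event m h \<longrightarrow> G (Suc m) \<omega> \<in> set_pmf (dd_step p (h m))"
    unfolding AE_all_countable
    by (intro allI AE_finite_allI finite_paths AE_step finite_set_dd_step paths_clique_graph)
  with AE_reachable AE_space show ?thesis
  proof eventually_elim
    case (elim \<omega>)
    show ?case
      using elim path_of_reachable[of \<omega>] by fastforce
  qed
qed

text \<open>The martingale property on one past: the mean being subtracted is a constant
  \<open>e\<close> there, and the successors carry the kernel weights, under which
  \<open>F - e\<close> averages to 0.\<close>

lemma expectation_noise_path_event:
  assumes h: "h \<in> paths m"
  shows "integrable M (\<lambda>\<omega>. indicator (path_event m h) \<omega> * noise F m \<omega>)"
    and "expectation (\<lambda>\<omega>. indicator (path_event m h) \<omega> * noise F m \<omega>) = 0"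
proof -
  define S where "S = set_pmf (dd_step p (h m))"
  define e where "e = measure_pmf.expectation (dd_step p (h m)) F"
  have fin: "finite S" unfolding S_def by (intro finite_set_dd_step paths_clique_graph h)
  have e: "e = (\<Sum>g\<in>S. pmf (dd_step p (h m)) g * F g)"
    unfolding e_def using fin by (subst integral_measure_pmf[of S]) (auto simp: S_def)
  have eq: "AE \<omega> in M. indicator (path_event m h) \<omega> * noise F m \<omega> =
      (\<Sum>g\<in>S. indicator (step_event m h g) \<omega> * (F g - e))"
    using AE_step[where h = h and m = m, OF fin[unfolded S_def]] AE_space
  proof eventually_elim
    case (elim \<omega>)
    show ?case
    proof (cases "\<omega> \<in> path_event m h")
      case True
      then have "(\<Sum>g\<in>S. indicator (step_event m h g) \<omega> * (F g - e)) =
          (\<Sum>g\<in>S. if g = G (Suc m) \<omega> then F g - e else 0)"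
        using elim by (intro sum.cong) (auto simp: step_event_eq indicator_def)
      also have "\<dots> = F (G (Suc m) \<omega>) - e" using True elim fin by (simp add: S_def)
      finally show ?thesis using True by (simp add: noise_def e_def path_event_def)
    next
      case False
      then show ?thesis by (simp add: step_event_eq)
    qed
  qed
  have int: "integrable M (\<lambda>\<omega>. \<Sum>g\<in>S. indicator (step_event m h g) \<omega> * (F g - e))"
    by (intro Bochner_Integration.integrable_sum integrable_mult_left) (simp add: emeasure_eq_measure)
  show "integrable M (\<lambda>\<omega>. indicator (path_event m h) \<omega> * noise F m \<omega>)"
    by (rule integrable_cong_AE_imp[OF int]) (use eq in \<open>auto elim: eventually_mono\<close>)
  have "expectation (\<lambda>\<omega>. indicator (path_event m h) \<omega> * noise F m \<omega>) =
      expectation (\<lambda>\<omega>. \<Sum>g\<in>S. indicator (step_event m h g) \<omega> * (F g - e))"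
    by (intro integral_cong_AE eq) auto
  also have "\<dots> = (\<Sum>g\<in>S. prob (step_event m h g) * (F g - e))"
    by (subst Bochner_Integration.integral_sum) (auto simp: emeasure_eq_measure)
  also have "\<dots> = prob (path_event m h) * ((\<Sum>g\<in>S. pmf (dd_step p (h m)) g * F g) - e * (\<Sum>g\<in>S. pmf (dd_step p (h m)) g))"
    by (simp add: prob_step_event sum_distrib_left sum_subtractf[symmetric] algebra_simps)
  also have "\<dots> = 0" using fin by (simp add: e S_def sum_pmf_eq_1)
  finally show "expectation (\<lambda>\<omega>. indicator (path_event m h) \<omega> * noise F m \<omega>) = 0" .
qed

text \<open>Orthogonality of the noise to the past: a functional of the states up to time
  \<open>m\<close> is constant on each path event, so it factors out of the vanishing
  expectations.\<close>

lemma expectation_past_times_noise: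
  fixes \<Phi> :: "(nat \<Rightarrow> graph) \<Rightarrow> real"
  assumes past: "\<And>h h'. (\<And>i. i \<le> m \<Longrightarrow> h i = h' i) \<Longrightarrow> \<Phi> h = \<Phi> h'"
    and meas: "(\<lambda>\<omega>. \<Phi> (\<lambda>i. G i \<omega>)) \<in> borel_measurable M"
  shows "integrable M (\<lambda>\<omega>. \<Phi> (\<lambda>i. G i \<omega>) * noise F m \<omega>)"
    and "expectation (\<lambda>\<omega>. \<Phi> (\<lambda>i. G i \<omega>) * noise F m \<omega>) = 0"
proof -
  note [measurable] = meas
  have eq: "AE \<omega> in M. \<Phi> (\<lambda>i. G i \<omega>) * noise F m \<omega> =
      (\<Sum>h\<in>paths m. \<Phi> h * (indicator (path_event m h) \<omega> * noise F m \<omega>))"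
    using AE_reachable AE_space
  proof eventually_elim
    case (elim \<omega>)
    \<comment> \<open>The restricted trajectory is the representative in \<open>paths m\<close> of
      the past actually followed; exactly one indicator in the sum is nonzero.\<close>
    define h0 where "h0 = restrict (\<lambda>i. G i \<omega>) {..m}"
    have h0: "h0 \<in> paths m" unfolding h0_def using elim by (intro path_of_reachable) auto
    have "indicator (path_event m h) \<omega> = (if h = h0 then 1 else (0::real))" if "h \<in> paths m" for h
    proof -
      have "\<omega> \<in> path_event m h \<longleftrightarrow> h = h0"
      proof
        assume "\<omega> \<in> path_event m h"
        then show "h = h0" using that
          by (intro ext) (auto simp: path_event_def h0_def paths_def PiE_def extensional_def restrict_def)
      qed (use elim in \<open>auto simp: path_event_def h0_def\<close>)
      then show ?thesis by (simp add: indicator_def)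
    qed
    then have "(\<Sum>h\<in>paths m. \<Phi> h * (indicator (path_event m h) \<omega> * noise F m \<omega>)) =
      (\<Sum>h\<in>paths m. if h = h0 then \<Phi> h * noise F m \<omega> else 0)"
      by (intro sum.cong) auto
    also have "\<dots> = \<Phi> h0 * noise F m \<omega>" using h0 finite_paths by simp
    also have "\<Phi> h0 = \<Phi> (\<lambda>i. G i \<omega>)" by (rule past) (simp add: h0_def)
    finally show ?case ..
  qed
  have int: "integrable M (\<lambda>\<omega>. \<Sum>h\<in>paths m. \<Phi> h * (indicator (path_event m h) \<omega> * noise F m \<omega>))"
    by (intro Bochner_Integration.integrable_sum integrable_mult_right expectation_noise_path_event)
  show "integrable M (\<lambda>\<omega>. \<Phi> (\<lambda>i. G i \<omega>) * noise F m \<omega>)"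
    by (rule integrable_cong_AE_imp[OF int]) (use eq in \<open>auto elim: eventually_mono\<close>)
  have "expectation (\<lambda>\<omega>. \<Phi> (\<lambda>i. G i \<omega>) * noise F m \<omega>) =
     expectation (\<lambda>\<omega>. \<Sum>h\<in>paths m. \<Phi> h * (indicator (path_event m h) \<omega> * noise F m \<omega>))"
    by (intro integral_cong_AE eq) auto
  also have "\<dots> = 0"
    by (subst Bochner_Integration.integral_sum)
       (auto intro!: sum.neutral integrable_mult_right expectation_noise_path_event simp: expectation_noise_path_event(2))
  finally show "expectation (\<lambda>\<omega>. \<Phi> (\<lambda>i. G i \<omega>) * noise F m \<omega>) = 0" .
qed

text \<open>One \<open>C\<close> bounds the jump itself and the other bounds its conditional
  mean.\<close>

lemma AE_noise_bound:
  assumes F: "\<And>g g'. clique_graph g \<Longrightarrow> g' \<in> set_pmf (dd_step p g) \<Longrightarrow> \<bar>F g' - F g\<bar> \<le> C"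
  shows "AE \<omega> in M. \<forall>m. \<bar>noise F m \<omega>\<bar> \<le> 2 * C"
  using AE_path
proof eventually_elim
  case (elim \<omega>)
  show ?case
  proof
    fix m
    let ?g = "G m \<omega>" and ?\<mu> = "dd_step p (G m \<omega>)"
    have g: "clique_graph ?g" using elim reachable_clique_graph by blast
    have int: "integrable (measure_pmf ?\<mu>) f" for f :: "graph \<Rightarrow> real"
      by (intro integrable_measure_pmf_finite finite_set_dd_step g)
    have "\<bar>measure_pmf.expectation ?\<mu> F - F ?g\<bar> = \<bar>measure_pmf.expectation ?\<mu> (\<lambda>g'. F g' - F ?g)\<bar>"
      by (simp add: int)
    also have "\<dots> \<le> measure_pmf.expectation ?\<mu> (\<lambda>g'. \<bar>F g' - F ?g\<bar>)"
      by (rule integral_abs_bound)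
    also have "\<dots> \<le> C"
      by (intro measure_pmf.integral_le_const int) (auto simp: AE_measure_pmf_iff F[OF g])
    finally show "\<bar>noise F m \<omega>\<bar> \<le> 2 * C"
      using F[OF g, of "G (Suc m) \<omega>"] elim by (auto simp: noise_def)
  qed
qed

text \<open>A strong law for bounded martingale increments: orthogonality makes the second moments
  add up, so that of the partial sum grows at most linearly.\<close>

lemma AE_noise_average_tendsto_0:
  assumes F: "\<And>g g'. clique_graph g \<Longrightarrow> g' \<in> set_pmf (dd_step p g) \<Longrightarrow> \<bar>F g' - F g\<bar> \<le> C"
  shows "AE \<omega> in M. (\<lambda>m. (\<Sum>i<m. noise F i \<omega>) / real m) \<longlonglongrightarrow> 0"
proof -
  define R where "R m \<omega> = (\<Sum>i<m. noise F i \<omega>)" for m \<omega>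
  have R_meas [measurable]: "R m \<in> borel_measurable M" for m unfolding R_def by measurable
  have bound: "AE \<omega> in M. \<bar>noise F m \<omega>\<bar> \<le> 2 * C" for m
    using AE_noise_bound[of F C] F by (auto elim: eventually_mono)
  have R_bound: "AE \<omega> in M. \<bar>R m \<omega>\<bar> \<le> real m * (2 * C)" for m
    using AE_noise_bound[of F C, OF F, simplified]
  proof eventually_elim
    case (elim \<omega>)
    then have "\<bar>R m \<omega>\<bar> \<le> (\<Sum>i<m. 2 * C)"
      unfolding R_def by (intro order.trans[OF sum_abs] sum_mono) auto
    then show ?case by simp
  qed
  have R_sq: "integrable M (\<lambda>\<omega>. (R m \<omega>)\<^sup>2)" for m
  proof (rule integrable_const_bound)
    show "AE \<omega> in M. norm ((R m \<omega>)\<^sup>2) \<le> (real m * (2 * C))\<^sup>2"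
      using R_bound[of m]
    proof eventually_elim
      case (elim \<omega>)
      then have "\<bar>R m \<omega>\<bar> \<le> \<bar>real m * (2 * C)\<bar>" by linarith
      then show ?case by (simp add: abs_le_square_iff)
    qed
  qed simp
  have noise_sq: "AE \<omega> in M. norm ((noise F m \<omega>)\<^sup>2) \<le> (2 * C)\<^sup>2" for m
    using bound[of m]
  proof eventually_elim
    case (elim \<omega>)
    then have "\<bar>noise F m \<omega>\<bar> \<le> \<bar>2 * C\<bar>" by linarith
    then show ?case by (simp add: abs_le_square_iff)
  qed
  have noise_int: "integrable M (\<lambda>\<omega>. (noise F m \<omega>)\<^sup>2)" for m
    by (rule integrable_const_bound[OF noise_sq]) simp
  have var: "expectation (\<lambda>\<omega>. (R m \<omega>)\<^sup>2) \<le> (2 * C)\<^sup>2 * real m" for m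
  proof (induction m)
    case (Suc m)
    \<comment> \<open>The sum stops at \<open>i < m\<close>, so the largest index read is
      \<open>Suc i <= m\<close> and \<open>R m\<close> is a function of the past up to time
      \<open>m\<close>.\<close>
    define \<Phi> where "\<Phi> h = (\<Sum>i<m. F (h (Suc i)) - measure_pmf.expectation (dd_step p (h i)) F)" for h
    have \<Phi>: "\<Phi> (\<lambda>i. G i \<omega>) = R m \<omega>" for \<omega> by (simp add: \<Phi>_def R_def noise_def)
    have past: "\<Phi> h = \<Phi> h'" if "\<And>i. i \<le> m \<Longrightarrow> h i = h' i" for h h'
      unfolding \<Phi>_def by (intro sum.cong refl) (simp add: that)
    have orth: "integrable M (\<lambda>\<omega>. R m \<omega> * noise F m \<omega>)" "expectation (\<lambda>\<omega>. R m \<omega> * noise F m \<omega>) = 0"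
      using expectation_past_times_noise[of m \<Phi>, OF past] unfolding \<Phi> by auto
    have "expectation (\<lambda>\<omega>. (R (Suc m) \<omega>)\<^sup>2)
        = expectation (\<lambda>\<omega>. (R m \<omega>)\<^sup>2 + 2 * (R m \<omega> * noise F m \<omega>) + (noise F m \<omega>)\<^sup>2)"
      by (simp add: R_def power2_sum algebra_simps)
    also have "\<dots> = expectation (\<lambda>\<omega>. (R m \<omega>)\<^sup>2) + expectation (\<lambda>\<omega>. (noise F m \<omega>)\<^sup>2)"
      using R_sq noise_int orth by simp
    also have "expectation (\<lambda>\<omega>. (noise F m \<omega>)\<^sup>2) \<le> (2 * C)\<^sup>2"
      using noise_sq[of m] by (intro integral_le_const noise_int) (auto elim: eventually_mono)
    finally show ?case using Suc by (simp add: algebra_simps)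
  qed (simp add: R_def)
  have inc: "AE \<omega> in M. \<bar>R (Suc m) \<omega> - R m \<omega>\<bar> \<le> 2 * C" for m
    using bound[of m] by (simp add: R_def)
  show ?thesis
    using AE_average_tendsto_0[OF R_meas R_sq var inc] by (simp add: R_def)
qed

end

section \<open>Convergence of the clique proportions\<close>

context dd_process
begin

text \<open>The drift is the constant \<open>p\<close>, so the noise telescopes to
  \<open>num_verts - 1 - m * p\<close>, where 1 counts the initial vertex.\<close>

lemma AE_num_verts_growth:
  assumes p: "0 < p" "p < 1"
  shows "AE \<omega> in M. (\<lambda>m. real (num_verts (G m \<omega>)) / real m) \<longlonglongrightarrow> p"
proof -
  have "AE \<omega> in M. (\<lambda>m. (\<Sum>i<m. noise (\<lambda>g. real (num_verts g)) i \<omega>) / real m) \<longlonglongrightarrow> 0"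
    by (rule AE_noise_average_tendsto_0[where C = 1]) (rule num_verts_step)
  with AE_path show ?thesis
  proof eventually_elim
    case (elim \<omega>)
    have noise_eq: "noise (\<lambda>g. real (num_verts g)) i \<omega> = real (num_verts (G (Suc i) \<omega>)) - real (num_verts (G i \<omega>)) - p" for i
    proof -
      have "clique_graph (G i \<omega>)" using elim(1) reachable_clique_graph by blast
      then show ?thesis by (simp add: noise_def expectation_num_verts[OF p])
    qed
    have sum: "(\<Sum>i<m. noise (\<lambda>g. real (num_verts g)) i \<omega>) = real (num_verts (G m \<omega>)) - 1 - real m * p" for m
    proof (induction m)
      case 0
      have "G 0 \<omega> = Graph {0} {}" using elim(1)[rule_format, of 0] by simp
      then show ?case by (simp add: num_verts_def)
    next
      case (Suc m)
      then show ?case by (simp add: noise_eq[of m] algebra_simps)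
    qed
    have "(\<lambda>m. (\<Sum>i<m. noise (\<lambda>g. real (num_verts g)) i \<omega>) / real m + 1 / real m + p) \<longlonglongrightarrow> 0 + 0 + p"
      by (intro tendsto_add elim lim_const_over_n tendsto_const)
    moreover have "\<forall>\<^sub>F m in sequentially. (\<Sum>i<m. noise (\<lambda>g. real (num_verts g)) i \<omega>) / real m + 1 / real m + p
        = real (num_verts (G m \<omega>)) / real m"
      using eventually_gt_at_top[of 0] by eventually_elim (simp add: sum field_simps)
    ultimately show ?case by (simp add: tendsto_cong)
  qed
qed

lemma AE_class_proportion:
  assumes p: "0 < p" "p < 1" and d: "limit_sequence p d"
  shows "AE \<omega> in M. \<forall>k. (\<lambda>m. class_size p k (G m \<omega>) / real (num_verts (G m \<omega>))) \<longlonglongrightarrow> d k"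
proof -
  \<comment> \<open>The noise is taken from class size and vertex number together:
    \<open>F k\<close> equals \<open>N m * x k m\<close> along the path, the quantity whose
    recursion the deterministic lemma treats.\<close>
  define F where "F k g = class_size p k g - d k * real (num_verts g)" for k g
  obtain B where B: "\<And>k. \<bar>d k\<bar> \<le> B"
    using d by (auto simp: limit_sequence_def bounded_iff)
  have d0: "d 0 = (1 - p) / p" using d by (simp add: limit_sequence_def)
  have d_eq: "(real k + p) * d k = p * real k * d (k - 1) + (1 - p) * real k * d (k + 1)" if "k \<ge> 1" for k
  proof -
    have "d k = balance p d k" using d that by (simp add: limit_sequence_iff)
    then show ?thesis using p by (simp add: balance_def field_simps)
  qed
  have "AE \<omega> in M. (\<lambda>m. (\<Sum>i<m. noise (F k) i \<omega>) / real m) \<longlonglongrightarrow> 0" if k: "k \<ge> 1" for k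
  proof (rule AE_noise_average_tendsto_0)
    fix g g' assume g: "clique_graph g" "g' \<in> set_pmf (dd_step p g)"
    have "\<bar>F k g' - F k g\<bar> = \<bar>(class_size p k g' - class_size p k g) - d k * (real (num_verts g') - real (num_verts g))\<bar>"
      by (simp add: F_def algebra_simps)
    also have "\<dots> \<le> \<bar>class_size p k g' - class_size p k g\<bar> + \<bar>d k\<bar> * \<bar>real (num_verts g') - real (num_verts g)\<bar>"
      unfolding abs_mult[symmetric] by (rule abs_triangle_ineq4)
    also have "\<dots> \<le> (real k + 1) + B * 1"
      using class_size_step[OF g(1) k g(2)] num_verts_step[OF g] B[of k] by (intro add_mono mult_mono) auto
    finally show "\<bar>F k g' - F k g\<bar> \<le> (real k + 1) + B * 1" .
  qed
  then have "AE \<omega> in M. \<forall>k. k \<ge> 1 \<longrightarrow> (\<lambda>m. (\<Sum>i<m. noise (F k) i \<omega>) / real m) \<longlonglongrightarrow> 0"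
    unfolding AE_all_countable by (auto intro: AE_I2)
  with AE_path AE_num_verts_growth[OF p] show ?thesis
  proof eventually_elim
    case (elim \<omega>)
    define N where "N m = real (num_verts (G m \<omega>))" for m
    define c where "c k m = class_size p k (G m \<omega>)" for k m
    define x where "x k m = c k m / N m - d k" for k m
    have good: "clique_graph (G m \<omega>)" for m using elim reachable_clique_graph by blast
    have N: "N m > 0" for m using num_verts_pos[OF good] by (simp add: N_def)
    have c_x: "c k m = N m * (x k m + d k)" for k m using N[of m] by (simp add: x_def)
    have "x k \<longlonglongrightarrow> 0" for k
    proof (rule relative_deviation_tendsto_0[OF p N])
      show "(\<lambda>m. N m / real m) \<longlonglongrightarrow> p" unfolding N_def by (rule elim)
      show x0: "x 0 m = 0" for m
        using N[of m] by (simp add: x_def c_def class_size_def d0 N_def)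
      \<comment> \<open>Class 0 is treated apart because its ratio \<open>(1 - p) / p\<close> may
        exceed 1; its deviation is 0 anyway.\<close>
      show "\<bar>x k m\<bar> \<le> 1 + B" for k m
      proof (cases "k = 0")
        case True
        then show ?thesis using x0[of m] B[of 0] by simp
      next
        case False
        then have "0 \<le> c k m / N m" "c k m / N m \<le> 1"
          using class_size_bounds[OF good, of k p m] N[of m] by (simp_all add: c_def N_def)
        then show ?thesis using B[of k] unfolding x_def by linarith
      qed
      fix k :: nat assume k: "k \<ge> 1"
      show "(\<lambda>m. (\<Sum>i<m. noise (F k) i \<omega>) / real m) \<longlonglongrightarrow> 0" using elim k by blast
      show "N (Suc m) * x k (Suc m) = N m * x k m
          + real k * (p * x (k - 1) m + (1 - p) * x (k + 1) m - x k m) + noise (F k) m \<omega>" for m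
      proof -
        have int: "integrable (measure_pmf (dd_step p (G m \<omega>))) f" for f :: "graph \<Rightarrow> real"
          by (intro integrable_measure_pmf_finite finite_set_dd_step good)
        have "measure_pmf.expectation (dd_step p (G m \<omega>)) (F k) =
            measure_pmf.expectation (dd_step p (G m \<omega>)) (class_size p k)
            - d k * measure_pmf.expectation (dd_step p (G m \<omega>)) (\<lambda>g. real (num_verts g))"
          unfolding F_def by (simp add: int)
        also have "\<dots> = c k m + real k * (p * c (k - 1) m + (1 - p) * c (k + 1) m - c k m) / N m - d k * (N m + p)"
          using expectation_class_size[OF p good k] expectation_num_verts[OF p good] by (simp add: c_def N_def)
        also have "real k * (p * c (k - 1) m + (1 - p) * c (k + 1) m - c k m) / N m
            = real k * (p * (x (k - 1) m + d (k - 1)) + (1 - p) * (x (k + 1) m + d (k + 1)) - (x k m + d k))"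
          unfolding c_x using N[of m] by (simp add: field_simps)
        \<comment> \<open>The growth of the graph contributes \<open>- p * d k\<close> and the
          outflow \<open>- k * d k\<close>; together they cancel the inflow at \<open>d\<close> by
          the recursion, whose denominator \<open>k + p\<close> arises this way. What remains is
          linear in the deviations.\<close>
        finally have "measure_pmf.expectation (dd_step p (G m \<omega>)) (F k) =
            N m * x k m + real k * (p * x (k - 1) m + (1 - p) * x (k + 1) m - x k m)"
          using d_eq[OF k] unfolding c_x by (simp add: algebra_simps)
        moreover have "F k (G (Suc m) \<omega>) = N (Suc m) * x k (Suc m)"
          using c_x[of k "Suc m"] by (simp add: F_def c_def N_def algebra_simps)
        ultimately show ?thesis by (simp add: noise_def)
      qed
    qed
    then have "(\<lambda>m. x k m + d k) \<longlonglongrightarrow> 0 + d k" for k by (intro tendsto_add tendsto_const)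
    then show ?case by (simp add: x_def c_def N_def)
  qed
qed

end

theorem theorem3p2:
  fixes p :: real and M :: "'w measure" and G :: "nat \<Rightarrow> 'w \<Rightarrow> graph"
  assumes "0 < p" and "p < 1"
    and "dd_process M p G"
  shows "\<exists>d. limit_sequence p d \<and> (\<forall>d'. limit_sequence p d' \<longrightarrow> d' = d) \<and>
    (\<forall>k\<ge>1. AE \<omega> in M.
      (\<lambda>m. real (num_verts_of_degree (k - 1) (G m \<omega>)) / real (num_verts (G m \<omega>))) \<longlonglongrightarrow> d k)"
proof -
  interpret dd_process M p G by (rule assms)
  obtain d where d: "limit_sequence p d" using limit_sequence_exists assms by blast
  have "AE \<omega> in M. (\<lambda>m. real (num_verts_of_degree (k - 1) (G m \<omega>)) / real (num_verts (G m \<omega>))) \<longlonglongrightarrow> d k"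
    if "k \<ge> 1" for k
    using AE_class_proportion[OF assms(1,2) d]
  proof eventually_elim
    case (elim \<omega>)
    then show ?case using elim[rule_format, of k] that by (simp add: class_size_def)
  qed
  then show ?thesis using d limit_sequence_unique[OF assms(1,2) d] by blast
qed

end
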